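(* The category $\mathcal{L}\mathrm{ens}$ has small coproducts.
   Context: All categories that are objects of $\mathcal{L}\mathrm{ens}$ are small. A (delta) lens $(f,\varphi)\colon A \rightleftharpoons B$ between small categories consists of a functor $f\colon A\to B$ together with a lifting operation assigning to each pair ($a\in A$, $u\colon fa\to b$ in $B$) a morphism $\varphi(a,u)\colon a\to a'$ of $A$ with domain $a$, such that (1) $f\varphi(a,u)=u$; (2) $\varphi(a,1_{fa})=1_a$; (3) $\varphi(a,v\circ u)=\varphi(a',v)\circ\varphi(a,u)$, where $a'$ is the codomain of $\varphi(a,u)$. $\mathcal{L}\mathrm{ens}$ is the category with small categories as objects and lenses as morphisms; the composite of $(f,\varphi)\colon A\rightleftharpoons B$ and $(g,\gamma)\colon B\rightleftharpoons C$ is the functor $g\circ f$ with lifting operation $(a,u\colon gfa\to c)\mapsto \varphi(a,\gamma(fa,u))$, and the identity lens on $A$ is the identity functor with lifting operation $(a,u)\mapsto u$. *)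

theory Defs
  imports Main "HOL-Library.FuncSet"
begin

unbundle cardinal_syntax

section \<open>Categories\<close>

record ('o, 'm) cat =
  Obj :: "'o set"
  Arr :: "'m set"
  Dom :: "'m \<Rightarrow> 'o"
  Cod :: "'m \<Rightarrow> 'o"
  Idn :: "'o \<Rightarrow> 'm"
  Cmp :: "'m \<Rightarrow> 'm \<Rightarrow> 'm"

text \<open>
  \<open>Cmp C g f\<close> is the composite \<open>g \<circ> f\<close>. Throughout, structure maps are required to be
  \<^term>\<open>undefined\<close> outside their domain of definition, so that HOL equality of the representing
  records is equality of the categories (functors, lenses) they represent.
\<close>

definition composable :: "('o, 'm) cat \<Rightarrow> 'm \<Rightarrow> 'm \<Rightarrow> bool" where
  "composable C g f \<longleftrightarrow> g \<in> Arr C \<and> f \<in> Arr C \<and> Cod C f = Dom C g"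

locale category =
  fixes C :: "('o, 'm) cat"
  assumes Dom_type: "Dom C \<in> Arr C \<rightarrow>\<^sub>E Obj C"
    and Cod_type: "Cod C \<in> Arr C \<rightarrow>\<^sub>E Obj C"
    and Idn_type: "Idn C \<in> Obj C \<rightarrow>\<^sub>E Arr C"
    and Dom_Idn: "a \<in> Obj C \<Longrightarrow> Dom C (Idn C a) = a"
    and Cod_Idn: "a \<in> Obj C \<Longrightarrow> Cod C (Idn C a) = a"
    and Cmp_Arr: "composable C g f \<Longrightarrow> Cmp C g f \<in> Arr C"
    and Dom_Cmp: "composable C g f \<Longrightarrow> Dom C (Cmp C g f) = Dom C f"
    and Cod_Cmp: "composable C g f \<Longrightarrow> Cod C (Cmp C g f) = Cod C g"
    and Cmp_undefined: "\<not> composable C g f \<Longrightarrow> Cmp C g f = undefined"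
    and Cmp_Idn_right: "f \<in> Arr C \<Longrightarrow> Cmp C f (Idn C (Dom C f)) = f"
    and Cmp_Idn_left: "f \<in> Arr C \<Longrightarrow> Cmp C (Idn C (Cod C f)) f = f"
    and Cmp_assoc: "composable C h g \<Longrightarrow> composable C g f \<Longrightarrow>
                      Cmp C h (Cmp C g f) = Cmp C (Cmp C h g) f"

definition hom :: "('o, 'm) cat \<Rightarrow> 'o \<Rightarrow> 'o \<Rightarrow> 'm set" where
  "hom C a b = {f \<in> Arr C. Dom C f = a \<and> Cod C f = b}"


section \<open>Small coproducts\<close>

text \<open>
  A type \<open>'u\<close> plays the role of the universe of sets: its elements are the possible elements of
  small sets, and a set of them is small if its cardinality is less than that of \<open>'u\<close>. If the
  cardinality of \<open>'u\<close> is inaccessible, then these are the small sets of a Grothendieck universe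
  (there, a subset of the universe is a member iff it has smaller cardinality). It suffices here
  that this cardinality is infinite and regular, i.e. that a small union of small sets is small.
\<close>

definition small :: "'u set \<Rightarrow> bool" where
  "small X \<longleftrightarrow> |X| <o |UNIV :: 'u set|"

definition regular_universe :: "'u itself \<Rightarrow> bool" where
  "regular_universe U \<longleftrightarrow> infinite (UNIV :: 'u set) \<and> regularCard |UNIV :: 'u set|"

definition is_coproduct ::
  "('o, 'm) cat \<Rightarrow> 'i set \<Rightarrow> ('i \<Rightarrow> 'o) \<Rightarrow> 'o \<Rightarrow> ('i \<Rightarrow> 'm) \<Rightarrow> bool" where
  "is_coproduct C I X c \<iota> \<longleftrightarrow>
     c \<in> Obj C \<and> (\<forall>i\<in>I. \<iota> i \<in> hom C (X i) c) \<and>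
     (\<forall>d\<in>Obj C. \<forall>g. (\<forall>i\<in>I. g i \<in> hom C (X i) d) \<longrightarrow>
        (\<exists>!h. h \<in> hom C c d \<and> (\<forall>i\<in>I. Cmp C h (\<iota> i) = g i)))"

definition has_small_coproducts :: "'u itself \<Rightarrow> ('o, 'm) cat \<Rightarrow> bool" where
  "has_small_coproducts U C \<longleftrightarrow>
     (\<forall>(I :: 'u set) X. small I \<and> (\<forall>i\<in>I. X i \<in> Obj C) \<longrightarrow> (\<exists>c \<iota>. is_coproduct C I X c \<iota>))"


section \<open>Lenses\<close>

record ('a, 'm, 'b, 'n) functor_data =
  obj_map :: "'a \<Rightarrow> 'b"
  arr_map :: "'m \<Rightarrow> 'n"

record ('a, 'm, 'b, 'n) lens_data = "('a, 'm, 'b, 'n) functor_data" +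
  lift :: "'a \<Rightarrow> 'n \<Rightarrow> 'm"

locale cat_functor = A: category A + B: category B
  for A :: "('a, 'm) cat" and B :: "('b, 'n) cat" +
  fixes F :: "('a, 'm, 'b, 'n, 'z) functor_data_scheme"
  assumes obj_map_type: "obj_map F \<in> Obj A \<rightarrow>\<^sub>E Obj B"
    and arr_map_type: "arr_map F \<in> Arr A \<rightarrow>\<^sub>E Arr B"
    and Dom_arr_map: "u \<in> Arr A \<Longrightarrow> Dom B (arr_map F u) = obj_map F (Dom A u)"
    and Cod_arr_map: "u \<in> Arr A \<Longrightarrow> Cod B (arr_map F u) = obj_map F (Cod A u)"
    and arr_map_Idn: "a \<in> Obj A \<Longrightarrow> arr_map F (Idn A a) = Idn B (obj_map F a)"
    and arr_map_Cmp: "composable A v u \<Longrightarrow>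
                        arr_map F (Cmp A v u) = Cmp B (arr_map F v) (arr_map F u)"

definition liftable :: "('a, 'm) cat \<Rightarrow> ('b, 'n) cat \<Rightarrow> ('a \<Rightarrow> 'b) \<Rightarrow> 'a \<Rightarrow> 'n \<Rightarrow> bool" where
  "liftable A B f a u \<longleftrightarrow> a \<in> Obj A \<and> u \<in> Arr B \<and> Dom B u = f a"

locale lens = cat_functor A B L
  for A :: "('a, 'm) cat" and B :: "('b, 'n) cat" and L :: "('a, 'm, 'b, 'n) lens_data" +
  assumes lift_Arr: "liftable A B (obj_map L) a u \<Longrightarrow> lift L a u \<in> Arr A"
    and Dom_lift: "liftable A B (obj_map L) a u \<Longrightarrow> Dom A (lift L a u) = a"
    and lift_undefined: "\<not> liftable A B (obj_map L) a u \<Longrightarrow> lift L a u = undefined"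
    and arr_map_lift: "liftable A B (obj_map L) a u \<Longrightarrow> arr_map L (lift L a u) = u"
    and lift_Idn: "a \<in> Obj A \<Longrightarrow> lift L a (Idn B (obj_map L a)) = Idn A a"
    and lift_Cmp: "liftable A B (obj_map L) a u \<Longrightarrow> composable B v u \<Longrightarrow>
          lift L a (Cmp B v u) = Cmp A (lift L (Cod A (lift L a u)) v) (lift L a u)"

definition lens_id :: "('a, 'm) cat \<Rightarrow> ('a, 'm, 'a, 'm) lens_data" where
  "lens_id A =
     \<lparr> obj_map = (\<lambda>a\<in>Obj A. a),
       arr_map = (\<lambda>u\<in>Arr A. u),
       lift = (\<lambda>a u. if liftable A A (\<lambda>a. a) a u then u else undefined) \<rparr>"

definition lens_comp ::
  "('a, 'm) cat \<Rightarrow> ('c, 'p) cat \<Rightarrow> ('b, 'n, 'c, 'p) lens_data \<Rightarrow> ('a, 'm, 'b, 'n) lens_data \<Rightarrow>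
     ('a, 'm, 'c, 'p) lens_data" where
  "lens_comp A C G F =
     \<lparr> obj_map = compose (Obj A) (obj_map G) (obj_map F),
       arr_map = compose (Arr A) (arr_map G) (arr_map F),
       lift = (\<lambda>a u. if liftable A C (\<lambda>a. obj_map G (obj_map F a)) a u
                     then lift F a (lift G (obj_map F a) u) else undefined) \<rparr>"


section \<open>The category of small categories and lenses\<close>

definition small_cats :: "('u, 'u) cat set" where
  "small_cats = {A. category A \<and> small (Obj A) \<and> small (Arr A)}"

text \<open>
  An arrow of \<open>Lens\<close> is a triple \<open>(A, L, B)\<close>: a lens together with its source and target.
\<close>

type_synonym 'u lens_arrow =
  "('u, 'u) cat \<times> ('u, 'u, 'u, 'u) lens_data \<times> ('u, 'u) cat"

definition lens_arrows :: "'u lens_arrow set" where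
  "lens_arrows = {(A, L, B). A \<in> small_cats \<and> B \<in> small_cats \<and> lens A B L}"

definition Lens :: "(('u, 'u) cat, 'u lens_arrow) cat" where
  "Lens =
     \<lparr> Obj = small_cats,
       Arr = lens_arrows,
       Dom = (\<lambda>(A, L, B)\<in>lens_arrows. A),
       Cod = (\<lambda>(A, L, B)\<in>lens_arrows. B),
       Idn = (\<lambda>A\<in>small_cats. (A, lens_id A, A)),
       Cmp = (\<lambda>(B', G, C) (A, F, B).
                if (B', G, C) \<in> lens_arrows \<and> (A, F, B) \<in> lens_arrows \<and> B = B'
                then (A, lens_comp A C G F, C) else undefined) \<rparr>"


lemma lens_lens_id:
  assumes "category A" shows "lens A A (lens_id A)"
proof -
  interpret category A by fact
  note [simp] = Dom_Idn Cod_Idn Cmp_Arr Dom_Cmp Cod_Cmp Cmp_Idn_right Cmp_Idn_left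
  have [simp]: "u \<in> Arr A \<Longrightarrow> Dom A u \<in> Obj A" "u \<in> Arr A \<Longrightarrow> Cod A u \<in> Obj A"
    "a \<in> Obj A \<Longrightarrow> Idn A a \<in> Arr A" for u a
    using Dom_type Cod_type Idn_type by auto
  show ?thesis
    by unfold_locales (auto simp: lens_id_def liftable_def composable_def)
qed

lemma lens_lens_comp:
  assumes "lens A B F" "lens B C G" shows "lens A C (lens_comp A C G F)"
proof -
  interpret F: lens A B F by fact
  interpret G: lens B C G by fact
  have oF [simp]: "a \<in> Obj A \<Longrightarrow> obj_map F a \<in> Obj B" for a using F.obj_map_type by auto
  have aF [simp]: "u \<in> Arr A \<Longrightarrow> arr_map F u \<in> Arr B" for u using F.arr_map_type by auto
  have oG [simp]: "a \<in> Obj B \<Longrightarrow> obj_map G a \<in> Obj C" for a using G.obj_map_type by auto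
  have aG [simp]: "u \<in> Arr B \<Longrightarrow> arr_map G u \<in> Arr C" for u using G.arr_map_type by auto
  have A [simp]: "u \<in> Arr A \<Longrightarrow> Dom A u \<in> Obj A" "u \<in> Arr A \<Longrightarrow> Cod A u \<in> Obj A"
    "a \<in> Obj A \<Longrightarrow> Idn A a \<in> Arr A" for u a
    using F.A.Dom_type F.A.Cod_type F.A.Idn_type by auto
  have B [simp]: "u \<in> Arr B \<Longrightarrow> Dom B u \<in> Obj B" "u \<in> Arr B \<Longrightarrow> Cod B u \<in> Obj B"
    "a \<in> Obj B \<Longrightarrow> Idn B a \<in> Arr B" for u a
    using F.B.Dom_type F.B.Cod_type F.B.Idn_type by auto
  have C [simp]: "u \<in> Arr C \<Longrightarrow> Dom C u \<in> Obj C" "u \<in> Arr C \<Longrightarrow> Cod C u \<in> Obj C"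
    "a \<in> Obj C \<Longrightarrow> Idn C a \<in> Arr C" for u a
    using G.B.Dom_type G.B.Cod_type G.B.Idn_type by auto
  have LF: "a \<in> Obj A \<Longrightarrow> u \<in> Arr B \<Longrightarrow> Dom B u = obj_map F a \<Longrightarrow>
      lift F a u \<in> Arr A \<and> Dom A (lift F a u) = a \<and> arr_map F (lift F a u) = u \<and>
      obj_map F (Cod A (lift F a u)) = Cod B u" for a u
    using F.lift_Arr[of a u] F.Dom_lift[of a u] F.arr_map_lift[of a u]
      F.Cod_arr_map[of "lift F a u"] by (auto simp: liftable_def)
  have LG: "a \<in> Obj B \<Longrightarrow> u \<in> Arr C \<Longrightarrow> Dom C u = obj_map G a \<Longrightarrow>
      lift G a u \<in> Arr B \<and> Dom B (lift G a u) = a \<and> arr_map G (lift G a u) = u \<and>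
      obj_map G (Cod B (lift G a u)) = Cod C u" for a u
    using G.lift_Arr[of a u] G.Dom_lift[of a u] G.arr_map_lift[of a u]
      G.Cod_arr_map[of "lift G a u"] by (auto simp: liftable_def)
  have LGa: "a \<in> Obj A \<Longrightarrow> u \<in> Arr C \<Longrightarrow> Dom C u = obj_map G (obj_map F a) \<Longrightarrow>
      lift G (obj_map F a) u \<in> Arr B \<and> Dom B (lift G (obj_map F a) u) = obj_map F a" for a u
    using LG by simp
  show ?thesis
  proof
    fix a u v
    assume "liftable A C (obj_map (lens_comp A C G F)) a u" "composable C v u"
    then show "lift (lens_comp A C G F) a (Cmp C v u) =
        Cmp A (lift (lens_comp A C G F) (Cod A (lift (lens_comp A C G F) a u)) v)
          (lift (lens_comp A C G F) a u)"
      using LF LG LGa G.lift_Cmp[of "obj_map F a" u v] G.B.Cmp_Arr[of v u] G.B.Dom_Cmp[of v u]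
        F.lift_Cmp[of a "lift G (obj_map F a) u"
            "lift G (Cod B (lift G (obj_map F a) u)) v"]
      by (auto simp: lens_comp_def liftable_def composable_def compose_def)
  next
    fix a assume "a \<in> Obj A"
    then show "lift (lens_comp A C G F) a (Idn C (obj_map (lens_comp A C G F) a)) = Idn A a"
      using G.B.Dom_Idn G.lift_Idn F.lift_Idn
      by (auto simp: lens_comp_def liftable_def compose_def)
  next
    fix u v assume c: "composable A v u"
    then have "composable B (arr_map F v) (arr_map F u)"
      by (simp add: composable_def F.Cod_arr_map F.Dom_arr_map)
    with c show "arr_map (lens_comp A C G F) (Cmp A v u) =
        Cmp C (arr_map (lens_comp A C G F) v) (arr_map (lens_comp A C G F) u)"
      using F.A.Cmp_Arr[OF c] F.arr_map_Cmp[OF c] G.arr_map_Cmp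
      by (auto simp: lens_comp_def compose_def composable_def)
  qed (use LF LG LGa in \<open>auto simp: lens_comp_def compose_def liftable_def F.Dom_arr_map
        F.Cod_arr_map G.Dom_arr_map G.Cod_arr_map F.arr_map_Idn G.arr_map_Idn
        split: if_splits\<close>)
qed

lemma lens_data_eqI:
  fixes L L' :: "('a, 'm, 'b, 'n) lens_data"
  assumes "lens A B L" "lens A B L'"
    and ob: "\<And>a. a \<in> Obj A \<Longrightarrow> obj_map L a = obj_map L' a"
    and ar: "\<And>u. u \<in> Arr A \<Longrightarrow> arr_map L u = arr_map L' u"
    and li: "\<And>a u. liftable A B (obj_map L) a u \<Longrightarrow> lift L a u = lift L' a u"
  shows "L = L'"
proof -
  interpret L: lens A B L by fact
  interpret L': lens A B L' by fact
  have o: "obj_map L = obj_map L'"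
    using L.obj_map_type L'.obj_map_type ob by (blast intro: PiE_ext)
  have "arr_map L = arr_map L'"
    using L.arr_map_type L'.arr_map_type ar by (blast intro: PiE_ext)
  moreover have "lift L a u = lift L' a u" for a u
    using li[of a u] L.lift_undefined[of a u] L'.lift_undefined[of a u] o by metis
  ultimately show ?thesis
    using o by (intro lens_data.equality) auto
qed

lemma lens_comp_id_right:
  assumes "lens A B F" shows "lens_comp A B F (lens_id A) = F"
proof -
  interpret F: lens A B F by fact
  show ?thesis
    by (rule lens_data_eqI[OF lens_lens_comp[OF lens_lens_id[OF F.A.category_axioms] assms] assms])
       (use F.lift_Arr F.Dom_lift in
         \<open>auto simp: lens_comp_def lens_id_def compose_def liftable_def\<close>)
qed

lemma lens_comp_id_left:
  assumes "lens A B F" shows "lens_comp A B (lens_id B) F = F"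
proof -
  interpret F: lens A B F by fact
  have [simp]: "a \<in> Obj A \<Longrightarrow> obj_map F a \<in> Obj B" "u \<in> Arr A \<Longrightarrow> arr_map F u \<in> Arr B" for a u
    using F.obj_map_type F.arr_map_type by auto
  show ?thesis
    by (rule lens_data_eqI[OF lens_lens_comp[OF assms lens_lens_id[OF F.B.category_axioms]] assms])
       (auto simp: lens_comp_def lens_id_def compose_def liftable_def)
qed

lemma lens_comp_assoc:
  assumes "lens A B F" "lens B C G" "lens C D H"
  shows "lens_comp A D H (lens_comp A C G F) = lens_comp A D (lens_comp B D H G) F"
proof -
  interpret F: lens A B F by fact
  interpret G: lens B C G by fact
  interpret H: lens C D H by fact
  have [simp]: "a \<in> Obj A \<Longrightarrow> obj_map F a \<in> Obj B" "u \<in> Arr A \<Longrightarrow> arr_map F u \<in> Arr B"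
    "b \<in> Obj B \<Longrightarrow> obj_map G b \<in> Obj C" for a u b
    using F.obj_map_type F.arr_map_type G.obj_map_type by auto
  show ?thesis
    by (rule lens_data_eqI[OF lens_lens_comp[OF lens_lens_comp[OF assms(1,2)] assms(3)]
            lens_lens_comp[OF assms(1) lens_lens_comp[OF assms(2,3)]]])
       (use H.lift_Arr H.Dom_lift in \<open>auto simp: lens_comp_def compose_def liftable_def\<close>)
qed

theorem category_Lens: "category (Lens :: (('u, 'u) cat, 'u lens_arrow) cat)"
proof
  show "Dom Lens \<in> Arr Lens \<rightarrow>\<^sub>E Obj (Lens :: (('u, 'u) cat, 'u lens_arrow) cat)"
    "Cod Lens \<in> Arr Lens \<rightarrow>\<^sub>E Obj (Lens :: (('u, 'u) cat, 'u lens_arrow) cat)"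
    by (auto simp: Lens_def lens_arrows_def)
  show "Idn Lens \<in> Obj Lens \<rightarrow>\<^sub>E Arr (Lens :: (('u, 'u) cat, 'u lens_arrow) cat)"
    by (auto simp: Lens_def lens_arrows_def small_cats_def intro: lens_lens_id)
qed (auto simp: Lens_def lens_arrows_def composable_def small_cats_def
      intro: lens_lens_id lens_lens_comp lens_comp_id_left lens_comp_id_right lens_comp_assoc
      split: if_splits)

end

theory Submission
  imports Defs
begin

text \<open>The coproduct is the disjoint union of the categories \<open>X i\<close>, with all
  structure componentwise. No arrow leaves its summand, so an arrow out of an object of the
  \<open>i\<close>-th summand is a tagged arrow of \<open>X i\<close> and lifts uniquely along the
  injection (\<open>lens_incl\<close>). Lenses \<open>G i\<close> into \<open>D\<close> combine to a
  lens that lifts at an object of the \<open>i\<close>-th summand as \<open>G i\<close> does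
  (\<open>lens_cotuple\<close>, \<open>lens_comp_cotuple_incl\<close>). It is the only such lens: a
  lift starting in a summand remains there and is recovered from the composite with that injection
  (\<open>lens_coprod_eqI\<close>). Regularity of the universe keeps the disjoint union small, and
  its infinitude allows pairs to be encoded as elements.\<close>

section \<open>Small disjoint unions and the encoding of pairs\<close>

text \<open>An infinite regular cardinal is stable: fewer than that many sets of smaller size have a
  disjoint union of smaller size.\<close>

lemma small_Sigma:
  assumes U: "regular_universe TYPE('u)"
    and I: "small (I :: 'u set)" and F: "\<And>i. i \<in> I \<Longrightarrow> small (F i :: 'u set)"
  shows "|SIGMA i:I. F i| <o |UNIV :: 'u set|"
proof -
  have "stable |UNIV :: 'u set|"
    using U by (intro regularCard_stable card_of_Card_order) (simp_all add: regular_universe_def Field_card_of)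
  then show ?thesis
    using I F unfolding small_def by (rule stable_elim)
qed

lemma infinite_pairing:
  assumes "infinite (UNIV :: 'u set)"
  obtains enc :: "'u \<times> 'u \<Rightarrow> 'u" where "bij enc"
proof -
  have "|(UNIV :: 'u set) \<times> (UNIV :: 'u set)| =o |UNIV :: 'u set|"
    using assms by (rule card_of_Times_same_infinite)
  then show thesis
    using that by (auto simp: card_of_ordIso[symmetric])
qed

text \<open>
  The tagged elements of a disjoint union have to be elements of the universe \<open>'u\<close> again, so
  tags are attached by an encoding of pairs.
\<close>

locale pairing =
  fixes pair :: "'u \<Rightarrow> 'u \<Rightarrow> 'u" and idx val :: "'u \<Rightarrow> 'u"
  assumes idx_pair [simp]: "idx (pair i a) = i"
    and val_pair [simp]: "val (pair i a) = a"
    and pair_idx_val [simp]: "pair (idx x) (val x) = x"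
begin

lemma pair_eq_iff: "pair i a = x \<longleftrightarrow> i = idx x \<and> a = val x"
  by auto

lemma small_tagged:
  assumes "regular_universe TYPE('u)" "small I" "\<And>i. i \<in> I \<Longrightarrow> small (F i)"
  shows "small {x. idx x \<in> I \<and> val x \<in> F (idx x)}"
proof -
  have "{x. idx x \<in> I \<and> val x \<in> F (idx x)} = (\<lambda>(i, a). pair i a) ` (SIGMA i:I. F i)"
    by (force simp: image_iff)
  then show ?thesis
    using ordLeq_ordLess_trans[OF card_of_image small_Sigma[OF assms]]
    by (simp add: small_def)
qed

section \<open>Disjoint unions of categories\<close>

text \<open>Every element of \<open>'u\<close> encodes a pair, so the total projections
  \<open>idx\<close> and \<open>val\<close> replace pattern matching.\<close>

definition coprod :: "'u set \<Rightarrow> ('u \<Rightarrow> ('u, 'u) cat) \<Rightarrow> ('u, 'u) cat" where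
  "coprod I X =
     \<lparr> Obj = {x. idx x \<in> I \<and> val x \<in> Obj (X (idx x))},
       Arr = {u. idx u \<in> I \<and> val u \<in> Arr (X (idx u))},
       Dom = (\<lambda>u\<in>{u. idx u \<in> I \<and> val u \<in> Arr (X (idx u))}.
                pair (idx u) (Dom (X (idx u)) (val u))),
       Cod = (\<lambda>u\<in>{u. idx u \<in> I \<and> val u \<in> Arr (X (idx u))}.
                pair (idx u) (Cod (X (idx u)) (val u))),
       Idn = (\<lambda>x\<in>{x. idx x \<in> I \<and> val x \<in> Obj (X (idx x))}.
                pair (idx x) (Idn (X (idx x)) (val x))),
       Cmp = (\<lambda>v u. if idx u \<in> I \<and> idx v = idx u \<and> composable (X (idx u)) (val v) (val u)
                then pair (idx u) (Cmp (X (idx u)) (val v) (val u)) else undefined) \<rparr>"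

lemma coprod_Obj [simp]: "x \<in> Obj (coprod I X) \<longleftrightarrow> idx x \<in> I \<and> val x \<in> Obj (X (idx x))"
  and coprod_Arr [simp]: "u \<in> Arr (coprod I X) \<longleftrightarrow> idx u \<in> I \<and> val u \<in> Arr (X (idx u))"
  by (auto simp: coprod_def)

lemma coprod_Dom [simp]: "idx u \<in> I \<Longrightarrow> val u \<in> Arr (X (idx u)) \<Longrightarrow>
    Dom (coprod I X) u = pair (idx u) (Dom (X (idx u)) (val u))"
  and coprod_Cod [simp]: "idx u \<in> I \<Longrightarrow> val u \<in> Arr (X (idx u)) \<Longrightarrow>
    Cod (coprod I X) u = pair (idx u) (Cod (X (idx u)) (val u))"
  and coprod_Idn [simp]: "idx x \<in> I \<Longrightarrow> val x \<in> Obj (X (idx x)) \<Longrightarrow>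
    Idn (coprod I X) x = pair (idx x) (Idn (X (idx x)) (val x))"
  by (auto simp: coprod_def)

text \<open>Domain and codomain carry the tag of their arrow, so matching ends force both arrows
  into one summand.\<close>

lemma coprod_composable: "composable (coprod I X) v u \<longleftrightarrow>
    idx u \<in> I \<and> idx v = idx u \<and> composable (X (idx u)) (val v) (val u)"
  by (auto simp: composable_def pair_eq_iff)

lemma coprod_Cmp: "Cmp (coprod I X) v u =
    (if composable (coprod I X) v u
     then pair (idx u) (Cmp (X (idx u)) (val v) (val u)) else undefined)"
  unfolding coprod_composable by (simp add: coprod_def)

lemma category_coprod:
  assumes "\<And>i. i \<in> I \<Longrightarrow> category (X i)"
  shows "category (coprod I X)"
proof -
  have T: "u \<in> Arr (X i) \<Longrightarrow> Dom (X i) u \<in> Obj (X i)" "u \<in> Arr (X i) \<Longrightarrow> Cod (X i) u \<in> Obj (X i)"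
    "a \<in> Obj (X i) \<Longrightarrow> Idn (X i) a \<in> Arr (X i)" if "i \<in> I" for i u a
    using category.Dom_type[OF assms[OF that]] category.Cod_type[OF assms[OF that]]
      category.Idn_type[OF assms[OF that]] by auto
  note R = category.Dom_Idn[OF assms] category.Cod_Idn[OF assms] category.Cmp_Arr[OF assms]
    category.Dom_Cmp[OF assms] category.Cod_Cmp[OF assms]
    category.Cmp_Idn_right[OF assms] category.Cmp_Idn_left[OF assms]
  show ?thesis
  proof
    show "Dom (coprod I X) \<in> Arr (coprod I X) \<rightarrow>\<^sub>E Obj (coprod I X)"
      "Cod (coprod I X) \<in> Arr (coprod I X) \<rightarrow>\<^sub>E Obj (coprod I X)"
      "Idn (coprod I X) \<in> Obj (coprod I X) \<rightarrow>\<^sub>E Arr (coprod I X)"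
      using T by (auto simp: coprod_def)
  next
    show "Dom (coprod I X) (Idn (coprod I X) a) = a"
      "Cod (coprod I X) (Idn (coprod I X) a) = a" if "a \<in> Obj (coprod I X)" for a
      using that by (simp_all add: T R)
  next
    fix g f assume "composable (coprod I X) g f"
    then show "Cmp (coprod I X) g f \<in> Arr (coprod I X)"
      "Dom (coprod I X) (Cmp (coprod I X) g f) = Dom (coprod I X) f"
      "Cod (coprod I X) (Cmp (coprod I X) g f) = Cod (coprod I X) g"
      by (auto simp: coprod_Cmp coprod_composable) (auto simp: composable_def R)
  next
    show "Cmp (coprod I X) g f = undefined" if "\<not> composable (coprod I X) g f" for g f
      using that by (simp add: coprod_Cmp)
  next
    fix f assume "f \<in> Arr (coprod I X)"
    then show "Cmp (coprod I X) f (Idn (coprod I X) (Dom (coprod I X) f)) = f"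
      "Cmp (coprod I X) (Idn (coprod I X) (Cod (coprod I X) f)) f = f"
      by (auto simp: coprod_Cmp coprod_composable composable_def T R)
  next
    fix h g f assume "composable (coprod I X) h g" "composable (coprod I X) g f"
    then show "Cmp (coprod I X) h (Cmp (coprod I X) g f) =
        Cmp (coprod I X) (Cmp (coprod I X) h g) f"
      using category.Cmp_assoc[OF assms, of "idx f" "val h" "val g" "val f"] R
      by (auto simp: coprod_Cmp coprod_composable) (auto simp: composable_def R)
  qed
qed

section \<open>Injections and cotuples\<close>

text \<open>The guard may use the unrestricted \<open>pair i\<close>, because
  \<open>liftable\<close> already demands that \<open>a\<close> be an object.\<close>

definition incl :: "'u set \<Rightarrow> ('u \<Rightarrow> ('u, 'u) cat) \<Rightarrow> 'u \<Rightarrow> ('u, 'u, 'u, 'u) lens_data" where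
  "incl I X i =
     \<lparr> obj_map = (\<lambda>a\<in>Obj (X i). pair i a),
       arr_map = (\<lambda>u\<in>Arr (X i). pair i u),
       lift = (\<lambda>a u. if liftable (X i) (coprod I X) (pair i) a u then val u else undefined) \<rparr>"

text \<open>An arrow with domain \<open>pair i a\<close> has tag \<open>i\<close>, so stripping the
  tag yields its only lift: the injection is a discrete opfibration.\<close>

lemma lens_incl:
  assumes "\<And>i. i \<in> I \<Longrightarrow> category (X i)" and i: "i \<in> I"
  shows "lens (X i) (coprod I X) (incl I X i)"
proof -
  interpret Q: category "coprod I X" using assms(1) by (rule category_coprod)
  interpret X: category "X i" using assms by simp
  have T [simp]: "u \<in> Arr (X i) \<Longrightarrow> Dom (X i) u \<in> Obj (X i)"
    "u \<in> Arr (X i) \<Longrightarrow> Cod (X i) u \<in> Obj (X i)"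
    "a \<in> Obj (X i) \<Longrightarrow> Idn (X i) a \<in> Arr (X i)" for u a
    using X.Dom_type X.Cod_type X.Idn_type by auto
  show ?thesis
  proof
    fix u v assume "composable (X i) v u"
    then show "arr_map (incl I X i) (Cmp (X i) v u) =
        Cmp (coprod I X) (arr_map (incl I X i) v) (arr_map (incl I X i) u)"
      \<comment> \<open>The arrow map is \<open>undefined\<close> off the arrows of
        \<open>X i\<close>, so the composite must be known to be one.\<close>
      using i X.Cmp_Arr[of v u]
      by (simp add: incl_def coprod_Cmp coprod_composable) (simp add: composable_def)
  next
    fix a u v
    assume "liftable (X i) (coprod I X) (obj_map (incl I X i)) a u" "composable (coprod I X) v u"
    then show "lift (incl I X i) a (Cmp (coprod I X) v u) =
        Cmp (X i) (lift (incl I X i) (Cod (X i) (lift (incl I X i) a u)) v) (lift (incl I X i) a u)"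
      using i X.Cmp_Arr[of "val v" "val u"] X.Dom_Cmp[of "val v" "val u"]
      by (auto simp: incl_def liftable_def coprod_Cmp coprod_composable pair_eq_iff composable_def)
  qed (use i in \<open>auto simp: incl_def liftable_def pair_eq_iff X.Dom_Idn\<close>)
qed

definition cotuple :: "'u set \<Rightarrow> ('u \<Rightarrow> ('u, 'u) cat) \<Rightarrow> ('u, 'u) cat \<Rightarrow>
    ('u \<Rightarrow> ('u, 'u, 'u, 'u) lens_data) \<Rightarrow> ('u, 'u, 'u, 'u) lens_data" where
  "cotuple I X D G =
     \<lparr> obj_map = (\<lambda>x\<in>Obj (coprod I X). obj_map (G (idx x)) (val x)),
       arr_map = (\<lambda>u\<in>Arr (coprod I X). arr_map (G (idx u)) (val u)),
       lift = (\<lambda>x u.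
         if liftable (coprod I X) D (\<lambda>x. obj_map (G (idx x)) (val x)) x u
         then pair (idx x) (lift (G (idx x)) (val x) u) else undefined) \<rparr>"

text \<open>Each law concerns data over a single summand, where it is the corresponding law of one
  \<open>G i\<close>.\<close>

lemma lens_cotuple:
  assumes D: "category D" and X: "\<And>i. i \<in> I \<Longrightarrow> category (X i)"
    and G: "\<And>i. i \<in> I \<Longrightarrow> lens (X i) D (G i)"
  shows "lens (coprod I X) D (cotuple I X D G)"
proof -
  interpret D: category D by fact
  interpret Q: category "coprod I X" using X by (rule category_coprod)
  have F: "cat_functor (X i) D (G i)" if "i \<in> I" for i
    using G[OF that] by (rule lens.axioms)
  have T [simp]: "u \<in> Arr (X i) \<Longrightarrow> Dom (X i) u \<in> Obj (X i)"
    "u \<in> Arr (X i) \<Longrightarrow> Cod (X i) u \<in> Obj (X i)"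
    "a \<in> Obj (X i) \<Longrightarrow> Idn (X i) a \<in> Arr (X i)"
    "a \<in> Obj (X i) \<Longrightarrow> obj_map (G i) a \<in> Obj D"
    "u \<in> Arr (X i) \<Longrightarrow> arr_map (G i) u \<in> Arr D" if "i \<in> I" for i u a
    using category.Dom_type[OF X[OF that]] category.Cod_type[OF X[OF that]]
      category.Idn_type[OF X[OF that]] cat_functor.obj_map_type[OF F[OF that]]
      cat_functor.arr_map_type[OF F[OF that]] by auto
  have TD [simp]: "b \<in> Obj D \<Longrightarrow> Idn D b \<in> Arr D" for b
    using D.Idn_type by auto
  note R [simp] = category.Cmp_Arr[OF X]
    cat_functor.Dom_arr_map[OF F] cat_functor.Cod_arr_map[OF F] cat_functor.arr_map_Idn[OF F]
    cat_functor.arr_map_Cmp[OF F] lens.lift_Idn[OF G]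
  \<comment> \<open>The last conjunct says that a further arrow \<open>v\<close> composable with
    \<open>u\<close> can be lifted at the end of the lift of \<open>u\<close>, as the composition
    law requires.\<close>
  have L: "lift (G i) a u \<in> Arr (X i) \<and> Dom (X i) (lift (G i) a u) = a \<and>
      arr_map (G i) (lift (G i) a u) = u \<and>
      obj_map (G i) (Cod (X i) (lift (G i) a u)) = Cod D u"
    if "i \<in> I" "a \<in> Obj (X i)" "u \<in> Arr D" "Dom D u = obj_map (G i) a" for i a u
    using that lens.lift_Arr[OF G, of i a u] lens.Dom_lift[OF G, of i a u]
      lens.arr_map_lift[OF G, of i a u] cat_functor.Cod_arr_map[OF F, of i "lift (G i) a u"]
    by (auto simp: liftable_def)
  show ?thesis
  proof
    fix x u v assume "liftable (coprod I X) D (obj_map (cotuple I X D G)) x u" "composable D v u"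
    then show "lift (cotuple I X D G) x (Cmp D v u) =
        Cmp (coprod I X)
          (lift (cotuple I X D G) (Cod (coprod I X) (lift (cotuple I X D G) x u)) v)
          (lift (cotuple I X D G) x u)"
      using L lens.lift_Cmp[OF G, of "idx x" "val x" u v] D.Cmp_Arr[of v u] D.Dom_Cmp[of v u]
      by (auto simp: cotuple_def liftable_def composable_def coprod_Cmp coprod_composable)
  next
    fix u v assume "composable (coprod I X) v u"
    then show "arr_map (cotuple I X D G) (Cmp (coprod I X) v u) =
        Cmp D (arr_map (cotuple I X D G) v) (arr_map (cotuple I X D G) u)"
      by (auto simp: cotuple_def coprod_Cmp coprod_composable) (auto simp: composable_def)
  qed (use L in \<open>auto simp: cotuple_def liftable_def D.Dom_Idn split: if_splits\<close>)
qed

text \<open>This is the existence half of the universal property; on lifts, the injection strips the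
  tag that the cotuple attaches.\<close>

lemma lens_comp_cotuple_incl:
  assumes D: "category D" and X: "\<And>i. i \<in> I \<Longrightarrow> category (X i)"
    and G: "\<And>i. i \<in> I \<Longrightarrow> lens (X i) D (G i)" and i: "i \<in> I"
  shows "lens_comp (X i) D (cotuple I X D G) (incl I X i) = G i"
proof -
  have ct: "lens (coprod I X) D (cotuple I X D G)"
    using D X G by (rule lens_cotuple)
  have incl: "lens (X i) (coprod I X) (incl I X i)"
    using X i by (rule lens_incl)
  show ?thesis
  proof (rule lens_data_eqI[OF lens_lens_comp[OF incl ct] G[OF i]])
    fix a u
    assume "liftable (X i) D (obj_map (lens_comp (X i) D (cotuple I X D G) (incl I X i))) a u"
    then show "lift (lens_comp (X i) D (cotuple I X D G) (incl I X i)) a u = lift (G i) a u"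
      \<comment> \<open>These facts show that the tagged lift is an arrow out of
        \<open>pair i a\<close>, so the guard of \<open>incl\<close> holds.\<close>
      using i lens.lift_Arr[OF G[OF i], of a u] lens.Dom_lift[OF G[OF i], of a u]
      by (auto simp: lens_comp_def cotuple_def incl_def liftable_def compose_def)
  qed (use i in \<open>auto simp: lens_comp_def cotuple_def incl_def compose_def\<close>)
qed

text \<open>
  The lift of a lens out of \<^term>\<open>coprod I X\<close> at an object of the \<open>i\<close>-th summand stays in that
  summand, so no information is lost by lifting it once more along \<^term>\<open>incl I X i\<close>.
\<close>

lemma lens_coprod_eqI:
  assumes X: "\<And>i. i \<in> I \<Longrightarrow> category (X i)"
    and H: "lens (coprod I X) D H" and K: "lens (coprod I X) D K"
    and eq: "\<And>i. i \<in> I \<Longrightarrow>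
      lens_comp (X i) D H (incl I X i) = lens_comp (X i) D K (incl I X i)"
  shows "H = K"
proof (rule lens_data_eqI[OF H K])
  show ob: "obj_map H x = obj_map K x" if "x \<in> Obj (coprod I X)" for x
    using that fun_cong[OF arg_cong[OF eq[of "idx x"], of obj_map], of "val x"]
    by (simp add: lens_comp_def incl_def compose_def)
  show "arr_map H u = arr_map K u" if "u \<in> Arr (coprod I X)" for u
    using that fun_cong[OF arg_cong[OF eq[of "idx u"], of arr_map], of "val u"]
    by (simp add: lens_comp_def incl_def compose_def)
  have *: "idx (lift L x u) = idx x \<and>
      val (lift L x u) = lift (lens_comp (X (idx x)) D L (incl I X (idx x))) (val x) u"
    if "lens (coprod I X) D L" "liftable (coprod I X) D (obj_map L) x u" for L x u
  proof -
    \<comment> \<open>The lift has domain \<open>x\<close>, and an arrow shares its tag with its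
      domain.\<close>
    have "lift L x u \<in> Arr (coprod I X)" "Dom (coprod I X) (lift L x u) = x"
      using lens.lift_Arr[OF that] lens.Dom_lift[OF that] by auto
    then show ?thesis
      using that(2) by (auto simp: lens_comp_def incl_def liftable_def pair_eq_iff)
  qed
  show "lift H x u = lift K x u" if l: "liftable (coprod I X) D (obj_map H) x u" for x u
  proof -
    have l': "liftable (coprod I X) D (obj_map K) x u"
      using l ob by (auto simp: liftable_def)
    have "idx x \<in> I"
      using l by (simp add: liftable_def)
    then show ?thesis
      using *[OF H l] *[OF K l'] eq pair_idx_val by metis
  qed
qed

section \<open>The universal property in \<open>Lens\<close>\<close>

lemma is_coproduct_coprod:
  assumes U: "regular_universe TYPE('u)" and I: "small I"
    and X: "\<And>i. i \<in> I \<Longrightarrow> X i \<in> small_cats"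
  shows "is_coproduct Lens I X (coprod I X) (\<lambda>i. (X i, incl I X i, coprod I X))"
proof -
  let ?Q = "coprod I X"
  have cX: "\<And>i. i \<in> I \<Longrightarrow> category (X i)"
    using X by (simp add: small_cats_def)
  \<comment> \<open>Regularity of the universe enters here, through
    \<open>small_tagged\<close>.\<close>
  have Q: "?Q \<in> small_cats"
    using category_coprod[OF cX] small_tagged[OF U I, of "\<lambda>i. Obj (X i)"]
      small_tagged[OF U I, of "\<lambda>i. Arr (X i)"] X
    by (simp add: small_cats_def coprod_def)
  have hom: "f \<in> hom Lens A B \<longleftrightarrow>
      (\<exists>L. f = (A, L, B) \<and> A \<in> small_cats \<and> B \<in> small_cats \<and> lens A B L)"
    for A B and f :: "'u lens_arrow"
    by (cases f) (auto simp: hom_def Lens_def lens_arrows_def)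
  have incl: "(X i, incl I X i, ?Q) \<in> lens_arrows" if "i \<in> I" for i
    using lens_incl[OF cX that] X[OF that] Q by (simp add: lens_arrows_def)
  have Cmp: "Cmp Lens (?Q, L, D) (X i, incl I X i, ?Q) = (X i, lens_comp (X i) D L (incl I X i), D)"
    if "i \<in> I" "D \<in> small_cats" "lens ?Q D L" for i D L
    using incl[OF that(1)] that Q by (simp add: Lens_def lens_arrows_def)
  have univ: "\<exists>!h. h \<in> hom Lens ?Q D \<and> (\<forall>i\<in>I. Cmp Lens h (X i, incl I X i, ?Q) = g i)"
    if D: "D \<in> small_cats" and g: "\<forall>i\<in>I. g i \<in> hom Lens (X i) D" for D g
  proof -
    \<comment> \<open>The middle component of an arrow triple is its lens.\<close>
    define G where "G i = fst (snd (g i))" for i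
    have G: "lens (X i) D (G i)" "g i = (X i, G i, D)" if "i \<in> I" for i
      using g that by (auto simp: hom G_def)
    have cD: "category D"
      using D by (simp add: small_cats_def)
    have ct: "lens ?Q D (cotuple I X D G)"
      using cD cX G(1) by (rule lens_cotuple)
    show ?thesis
    proof (rule ex1I[of _ "(?Q, cotuple I X D G, D)"])
      show "(?Q, cotuple I X D G, D) \<in> hom Lens ?Q D \<and>
          (\<forall>i\<in>I. Cmp Lens (?Q, cotuple I X D G, D) (X i, incl I X i, ?Q) = g i)"
        using ct D Q lens_comp_cotuple_incl[where X = X and G = G, OF cD cX G(1)] by (auto simp: hom Cmp G(2))
    next
      fix h assume h: "h \<in> hom Lens ?Q D \<and> (\<forall>i\<in>I. Cmp Lens h (X i, incl I X i, ?Q) = g i)"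
      then obtain L where L: "h = (?Q, L, D)" "lens ?Q D L"
        by (auto simp: hom)
      \<comment> \<open>Along every injection both lenses restrict to \<open>G i\<close>:
        \<open>L\<close> by the assumption on \<open>h\<close>, the cotuple by construction.\<close>
      have "L = cotuple I X D G"
        using h L D lens_comp_cotuple_incl[where X = X and G = G, OF cD cX G(1)]
        by (intro lens_coprod_eqI[OF cX L(2) ct]) (auto simp: Cmp G(2))
      with L show "h = (?Q, cotuple I X D G, D)"
        by simp
    qed
  qed
  have "Obj Lens = (small_cats :: ('u, 'u) cat set)"
    by (simp add: Lens_def)
  moreover have "(X i, incl I X i, ?Q) \<in> hom Lens (X i) ?Q" if "i \<in> I" for i
    using incl[OF that] by (simp add: hom lens_arrows_def)
  ultimately show ?thesis
    unfolding is_coproduct_def using Q univ by (intro conjI ballI allI impI) simp_all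
qed

end

theorem proposition4p5:
  assumes "regular_universe TYPE('u)"
  shows "has_small_coproducts TYPE('u) (Lens :: (('u, 'u) cat, 'u lens_arrow) cat)"
proof -
  obtain enc :: "'u \<times> 'u \<Rightarrow> 'u" where enc: "bij enc"
    using assms infinite_pairing by (auto simp: regular_universe_def)
  \<comment> \<open>Injectivity of \<open>enc\<close> gives the two projection laws, surjectivity
    the fact that every element is a pair.\<close>
  interpret pairing "\<lambda>i a. enc (i, a)" "\<lambda>x. fst (inv enc x)" "\<lambda>x. snd (inv enc x)"
    using enc by unfold_locales (auto simp: bij_is_inj bij_is_surj surj_f_inv_f)
  show ?thesis
    unfolding has_small_coproducts_def
    using is_coproduct_coprod[OF assms] by (fastforce simp: Lens_def)
qed

end
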